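(* Let $a\in(-1,0)\cup(0,1)$ and let $C_a$ be the Chebyshev's method of $p_a(z)=(z^2-1)(z^2-a)$. Then there is no invariant Siegel disk for $C_a$.
   Context: For a polynomial $p$, the Chebyshev's method of $p$ is the rational map $C_p(z)=z-\left[1+\frac12 L_p(z)\right]\frac{p(z)}{p'(z)}$ with $L_p(z)=\frac{p(z)p''(z)}{(p'(z))^2}$, regarded as a self-map of the Riemann sphere $\widehat{\mathbb C}$. For $p_a(z)=(z^2-1)(z^2-a)$ write $C_a:=C_{p_a}$. The Fatou set of $C_a$ is the set of points of $\widehat{\mathbb C}$ having a neighbourhood on which $\{C_a^n\}_{n>0}$ is normal; a Fatou component is a connected component of it. An invariant Siegel disk is a simply connected Fatou component $U$ with $C_a(U)=U$ on which $C_a$ is conformally conjugate to an irrational rotation of the unit disk about the origin. *)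

theory Defs
  imports
    "HOL-Complex_Analysis.Complex_Analysis"
    "HOL-Computational_Algebra.Computational_Algebra"
    "HOL-Computational_Algebra.Field_as_Ring"
begin

section \<open>The Riemann sphere\<close>

datatype riemann_sphere = Fin complex | Infty

text \<open>
  Inverse stereographic projection onto the unit sphere of \<open>\<complex> \<times> \<real>\<close>, with \<open>Infty\<close> as north pole.
  The distance on the Riemann sphere is the induced chordal metric.
\<close>

fun stereo :: "riemann_sphere \<Rightarrow> complex \<times> real" where
  "stereo (Fin z) =
     (2 * z / of_real ((cmod z)\<^sup>2 + 1), ((cmod z)\<^sup>2 - 1) / ((cmod z)\<^sup>2 + 1))"
| "stereo Infty = (0, 1)"

lemma stereo_snd_Fin: "snd (stereo (Fin z)) = 1 - 2 / ((cmod z)\<^sup>2 + 1)"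
proof -
  have "(cmod z)\<^sup>2 + 1 > 0"
    by (simp add: add_nonneg_pos)
  then show ?thesis
    by (simp add: field_simps)
qed

lemma inj_stereo: "inj stereo"
proof (rule injI)
  fix x y
  assume eq: "stereo x = stereo y"
  have pos: "(cmod z)\<^sup>2 + 1 > 0" for z
    by (simp add: add_nonneg_pos)
  have ne1: "snd (stereo (Fin z)) \<noteq> 1" for z
    using pos[of z] unfolding stereo_snd_Fin by simp
  show "x = y"
  proof (cases x)
    case x: (Fin z)
    show ?thesis
    proof (cases y)
      case y: (Fin w)
      have "snd (stereo (Fin z)) = snd (stereo (Fin w))"
        using eq x y by simp
      then have n: "(cmod z)\<^sup>2 + 1 = (cmod w)\<^sup>2 + 1"
        using pos[of z] pos[of w] unfolding stereo_snd_Fin by (simp add: field_simps)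
      have "2 * z / complex_of_real ((cmod z)\<^sup>2 + 1) = 2 * w / complex_of_real ((cmod w)\<^sup>2 + 1)"
        using eq x y by simp
      moreover have "complex_of_real ((cmod w)\<^sup>2 + 1) \<noteq> 0"
        using pos[of w] by (metis less_irrefl of_real_eq_0_iff)
      ultimately have "z = w"
        unfolding n by simp
      then show ?thesis using x y by simp
    next
      case Infty
      then show ?thesis using eq x ne1[of z] by (metis snd_conv stereo.simps(2))
    qed
  next
    case x: Infty
    show ?thesis
    proof (cases y)
      case (Fin w)
      then show ?thesis using eq x ne1[of w] by (metis snd_conv stereo.simps(2))
    qed (simp add: x)
  qed
qed

instantiation riemann_sphere :: metric_space
begin

definition dist_riemann_sphere :: "riemann_sphere \<Rightarrow> riemann_sphere \<Rightarrow> real" where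
  "dist_riemann_sphere x y = dist (stereo x) (stereo y)"

definition uniformity_riemann_sphere :: "(riemann_sphere \<times> riemann_sphere) filter" where
  "uniformity_riemann_sphere = (INF e\<in>{0<..}. principal {(x, y). dist x y < e})"

definition open_riemann_sphere :: "riemann_sphere set \<Rightarrow> bool" where
  "open_riemann_sphere U \<longleftrightarrow> (\<forall>x\<in>U. eventually (\<lambda>(x', y). x' = x \<longrightarrow> y \<in> U) uniformity)"

instance
proof
  fix x y z :: riemann_sphere
  show "dist x y = 0 \<longleftrightarrow> x = y"
    using inj_stereo by (auto simp: dist_riemann_sphere_def inj_eq)
  show "dist x y \<le> dist x z + dist y z"
    unfolding dist_riemann_sphere_def by (rule dist_triangle2)
qed (simp_all add: uniformity_riemann_sphere_def open_riemann_sphere_def)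

end

text \<open>The standard chart \<open>1/z\<close> around \<open>Infty\<close>, as a parametrisation.\<close>

definition chart_Infty :: "complex \<Rightarrow> riemann_sphere" where
  "chart_Infty w = (if w = 0 then Infty else Fin (1 / w))"

text \<open>Complex-valued holomorphic functions on an open subset of the Riemann sphere.\<close>

definition sphere_holomorphic_on :: "(riemann_sphere \<Rightarrow> complex) \<Rightarrow> riemann_sphere set \<Rightarrow> bool" where
  "sphere_holomorphic_on f U \<longleftrightarrow>
     (f \<circ> Fin) holomorphic_on (Fin -` U) \<and>
     (f \<circ> chart_Infty) holomorphic_on (chart_Infty -` U)"


section \<open>Rational maps and Chebyshev's method\<close>

text \<open>
  The components of \<open>quot_of_fract r\<close> are coprime polynomials and the second one is nonzero,
  so a zero of the denominator is a pole, and the value at \<open>Infty\<close> is determined by the degrees.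
\<close>

definition rational_map :: "complex poly fract \<Rightarrow> riemann_sphere \<Rightarrow> riemann_sphere" where
  "rational_map r x =
     (let (n, d) = quot_of_fract r in
      case x of
        Fin z \<Rightarrow> if poly d z = 0 then Infty else Fin (poly n z / poly d z)
      | Infty \<Rightarrow> if degree n > degree d then Infty else Fin (coeff n (degree d) / lead_coeff d))"

definition L_fract :: "complex poly \<Rightarrow> complex poly fract" where
  "L_fract p = to_fract p * to_fract (pderiv (pderiv p)) / (to_fract (pderiv p))\<^sup>2"

definition chebyshev_fract :: "complex poly \<Rightarrow> complex poly fract" where
  "chebyshev_fract p =
     to_fract [:0, 1:] - (1 + 1 / 2 * L_fract p) * (to_fract p / to_fract (pderiv p))"

definition chebyshev_method :: "complex poly \<Rightarrow> riemann_sphere \<Rightarrow> riemann_sphere" where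
  "chebyshev_method p = rational_map (chebyshev_fract p)"

definition p_poly :: "complex \<Rightarrow> complex poly" where
  "p_poly a = ([:0, 1:]\<^sup>2 - 1) * ([:0, 1:]\<^sup>2 - [:a:])"


section \<open>Fatou set and Siegel disks\<close>

text \<open>
  Normality: every sequence in the family has a subsequence converging locally uniformly
  in the chordal metric. As the sphere is locally compact, this is uniform convergence on
  compact subsets of the open set \<open>V\<close>.
\<close>

definition normal_family_on ::
  "riemann_sphere set \<Rightarrow> (riemann_sphere \<Rightarrow> riemann_sphere) set \<Rightarrow> bool" where
  "normal_family_on V \<F> \<longleftrightarrow>
     (\<forall>f :: nat \<Rightarrow> riemann_sphere \<Rightarrow> riemann_sphere. range f \<subseteq> \<F> \<longrightarrow>
        (\<exists>r g. strict_mono r \<and>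
           (\<forall>K. compact K \<and> K \<subseteq> V \<longrightarrow> uniform_limit K (f \<circ> r) g sequentially)))"

definition fatou_set :: "(riemann_sphere \<Rightarrow> riemann_sphere) \<Rightarrow> riemann_sphere set" where
  "fatou_set F = {x. \<exists>V. open V \<and> x \<in> V \<and> normal_family_on V {F ^^ n | n. n > 0}}"

definition invariant_Siegel_disk ::
  "(riemann_sphere \<Rightarrow> riemann_sphere) \<Rightarrow> riemann_sphere set \<Rightarrow> bool" where
  "invariant_Siegel_disk F U \<longleftrightarrow>
     U \<in> components (fatou_set F) \<and> simply_connected U \<and> F ` U = U \<and>
     (\<exists>\<phi>. \<exists>\<alpha>::real. sphere_holomorphic_on \<phi> U \<and> bij_betw \<phi> U (ball 0 1) \<and> \<alpha> \<notin> \<rat> \<and>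
        (\<forall>x\<in>U. \<phi> (F x) = exp (2 * of_real pi * \<i> * of_real \<alpha>) * \<phi> x))"

end

theory Submission
  imports Defs
begin

text \<open>
  The centre of an invariant Siegel disk is a fixed point whose multiplier is the non-real number
  \<open>exp (2 \<pi> \<i> \<alpha>)\<close>, so it suffices that all fixed points have real multipliers. At \<open>\<infinity>\<close> the
  multiplier is \<open>32/21\<close>. A finite fixed point \<open>z\<close> satisfies \<open>p z = 0\<close> or
  \<open>2 (p' z)\<^sup>2 + p z p'' z = 0\<close>. As \<open>p\<close> is even, the latter is a real cubic equation in \<open>z\<^sup>2\<close>, and
  sign changes exhibit three real roots; hence \<open>z\<^sup>2\<close> is real in all cases. The multiplier is a
  real rational function of \<open>z\<^sup>2\<close>, hence real as well.
\<close>

section \<open>Parametrisations of the sphere\<close>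

lemma continuous_on_riemann_sphere_iff:
  fixes h :: "'a::metric_space \<Rightarrow> riemann_sphere"
  shows "continuous_on S h \<longleftrightarrow> continuous_on S (stereo \<circ> h)"
  by (simp add: continuous_on_iff dist_riemann_sphere_def)

lemma continuous_on_Fin: "continuous_on UNIV Fin"
proof -
  have "(cmod z)\<^sup>2 + 1 \<noteq> 0" for z
    by (smt (verit) zero_le_power2)
  moreover from this have "complex_of_real ((cmod z)\<^sup>2 + 1) \<noteq> 0" for z
    by (metis of_real_eq_0_iff)
  ultimately have "continuous_on UNIV (\<lambda>z. stereo (Fin z))"
    unfolding stereo.simps by (intro continuous_intros) auto
  then show ?thesis
    by (simp add: continuous_on_riemann_sphere_iff comp_def)
qed

text \<open>Under \<open>stereo\<close>, inversion is the half-turn of the unit sphere that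
  conjugates the planar coordinate and negates the height. The formula is regular at
  \<open>w = 0\<close>, so continuity at \<open>Infty\<close> needs no separate limit.\<close>

lemma stereo_chart_Infty:
  "stereo (chart_Infty w) =
     (2 * cnj w / of_real ((cmod w)\<^sup>2 + 1), (1 - (cmod w)\<^sup>2) / ((cmod w)\<^sup>2 + 1))"
proof (cases "w = 0")
  case False
  have pos: "(cmod w)\<^sup>2 + 1 \<noteq> 0"
    by (smt (verit) zero_le_power2)
  have n: "(cmod (1 / w))\<^sup>2 + 1 = ((cmod w)\<^sup>2 + 1) / (cmod w)\<^sup>2"
    using False by (simp add: norm_divide field_simps)
  have "(cmod w)\<^sup>2 \<noteq> 0" using False by simp
  moreover have "complex_of_real ((cmod w)\<^sup>2) = w * cnj w"
    by (metis complex_norm_square)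
  ultimately have "2 * (1 / w) / complex_of_real ((cmod (1 / w))\<^sup>2 + 1) =
      2 * cnj w / of_real ((cmod w)\<^sup>2 + 1)"
    using False unfolding n of_real_divide by (simp add: field_simps)
  moreover have "((cmod (1 / w))\<^sup>2 - 1) / ((cmod (1 / w))\<^sup>2 + 1) =
      (1 - (cmod w)\<^sup>2) / ((cmod w)\<^sup>2 + 1)"
  proof -
    have m: "(cmod (1 / w))\<^sup>2 - 1 = (1 - (cmod w)\<^sup>2) / (cmod w)\<^sup>2"
      using False by (simp add: norm_divide field_simps)
    show ?thesis unfolding n m using False pos by simp
  qed
  ultimately show ?thesis
    using False by (simp add: chart_Infty_def)
qed (simp add: chart_Infty_def)

lemma continuous_on_chart_Infty: "continuous_on UNIV chart_Infty"
proof -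
  have "(cmod z)\<^sup>2 + 1 \<noteq> 0" for z
    by (smt (verit) zero_le_power2)
  moreover from this have "complex_of_real ((cmod z)\<^sup>2 + 1) \<noteq> 0" for z
    by (metis of_real_eq_0_iff)
  ultimately have "continuous_on UNIV (\<lambda>w. stereo (chart_Infty w))"
    unfolding stereo_chart_Infty by (intro continuous_intros) auto
  then show ?thesis
    by (simp add: continuous_on_riemann_sphere_iff comp_def)
qed

lemma inj_chart_Infty: "inj chart_Infty"
  by (auto simp: inj_def chart_Infty_def)

section \<open>Multiplier at the centre of a Siegel disk\<close>

lemma open_fatou_set: "open (fatou_set F)"
proof (subst open_subopen, intro ballI)
  fix x assume "x \<in> fatou_set F"
  then show "\<exists>T. open T \<and> x \<in> T \<and> T \<subseteq> fatou_set F"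
    unfolding fatou_set_def by blast
qed

text \<open>The preimage of \<open>S\<close> contains a ball, whose image is connected, lies in
  \<open>S\<close> and meets \<open>U\<close>. Openness of \<open>U\<close> itself, i.e. local
  connectedness of the sphere, is avoided in this way.\<close>

lemma ball_subset_component:
  fixes h :: "'a::real_normed_vector \<Rightarrow> 'b::metric_space"
  assumes "continuous_on UNIV h" and "open S" and "U \<in> components S" and "h w0 \<in> U"
  obtains r where "r > 0" "h ` ball w0 r \<subseteq> U"
proof -
  have "open (h -` S)"
    using assms(1,2) continuous_open_vimage continuous_on_eq_continuous_at open_UNIV by blast
  moreover have "w0 \<in> h -` S"
    using assms(3,4) in_components_subset by blast
  ultimately obtain r where r: "r > 0" "ball w0 r \<subseteq> h -` S"
    by (meson openE)
  have "connected (h ` ball w0 r)"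
    using assms(1) by (intro connected_continuous_image) (auto intro: continuous_on_subset)
  then have "h ` ball w0 r \<subseteq> U"
    using components_maximal[OF assms(3)] r assms(4) by (metis centre_in_ball disjoint_iff image_eqI image_subset_iff_subset_vimage)
  with r show ?thesis using that by blast
qed

text \<open>Here \<open>G\<close> is \<open>F\<close> read in the parametrisation \<open>h\<close>.
  Differentiating \<open>\<phi> (h (G w)) = c * \<phi> (h w)\<close> at \<open>w0\<close> gives the
  same factor on both sides, which is nonzero because an injective holomorphic function has no
  critical point.\<close>

lemma multiplier_of_linearisation:
  fixes h :: "complex \<Rightarrow> riemann_sphere"
  assumes h: "continuous_on UNIV h" "inj h"
    and U: "U \<in> components (fatou_set F)"
    and hol: "(\<phi> \<circ> h) holomorphic_on (h -` U)" and inj: "inj_on \<phi> U"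
    and lin: "\<And>x. x \<in> U \<Longrightarrow> \<phi> (F x) = c * \<phi> x"
    and w0: "h w0 \<in> U" "G w0 = w0"
    and G: "(G has_field_derivative l) (at w0)"
    and FG: "\<forall>\<^sub>F w in nhds w0. F (h w) = h (G w)"
  shows "l = c"
proof -
  obtain r where r: "r > 0" "h ` ball w0 r \<subseteq> U"
    using ball_subset_component[OF h(1) open_fatou_set U w0(1)] .
  let ?\<psi> = "\<phi> \<circ> h"
  have hol': "?\<psi> holomorphic_on ball w0 r"
    using hol r by (auto elim!: holomorphic_on_subset)
  have "inj_on ?\<psi> (ball w0 r)"
    using inj r h(2) by (intro comp_inj_on) (auto intro: inj_on_subset)
  then have d: "deriv ?\<psi> w0 \<noteq> 0"
    using holomorphic_injective_imp_regular[OF hol' open_ball] r by simp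
  have \<psi>: "(?\<psi> has_field_derivative deriv ?\<psi> w0) (at w0)"
    using hol' r by (intro holomorphic_derivI[OF _ open_ball]) auto
  have "(?\<psi> \<circ> G has_field_derivative deriv ?\<psi> w0 * l) (at w0)"
    using \<psi> G w0 by (intro DERIV_chain) simp_all
  moreover have "((\<lambda>w. c * ?\<psi> w) has_field_derivative c * deriv ?\<psi> w0) (at w0)"
    by (intro DERIV_cmult \<psi>)
  moreover have "\<forall>\<^sub>F w in nhds w0. (?\<psi> \<circ> G) w = c * ?\<psi> w"
    using FG eventually_nhds_ball[OF r(1)]
  proof eventually_elim
    case (elim w)
    then show ?case using lin[of "h w"] r(2) by (auto simp: image_subset_iff)
  qed
  ultimately have "deriv ?\<psi> w0 * l = c * deriv ?\<psi> w0"
    by (metis DERIV_cong_ev DERIV_unique)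
  then show ?thesis using d by simp
qed

lemma Rats_if_exp_2pi_i_real:
  assumes "exp (2 * of_real pi * \<i> * of_real \<alpha>) \<in> \<real>"
  shows "\<alpha> \<in> \<rat>"
proof -
  have "sin (2 * pi * \<alpha>) = 0"
    using assms by (simp add: complex_is_Real_iff Im_exp)
  then obtain k :: int where "2 * pi * \<alpha> = of_int k * pi"
    using sin_zero_iff_int2 by auto
  then have "\<alpha> = of_int k / 2" by simp
  then show ?thesis by (metis Rats_divide Rats_number_of Rats_of_int)
qed

section \<open>Rational maps and Chebyshev's method\<close>

text \<open>Relates the reduced fraction used by \<open>rational_map\<close> to an arbitrary
  representation \<open>N / D\<close>, so that no reduced form ever has to be computed.\<close>

lemma rational_map_cross_mult:
  assumes D: "D \<noteq> 0" and r: "r = to_fract N / to_fract D"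
    and nd: "quot_of_fract r = (n, d)"
  shows "poly n z * poly D z = poly N z * poly d z"
proof -
  have "d \<noteq> 0" using nd by (metis snd_conv snd_quot_of_fract_nonzero)
  moreover have "to_fract n / to_fract d = r"
    using Fract_quot_of_fract[of r] nd by (simp add: Fract_conv_to_fract)
  ultimately have "to_fract (n * D) = to_fract (N * d)"
    using D r by (simp add: field_simps)
  then show ?thesis by (metis poly_mult to_fract_eq_iff)
qed

lemma rational_map_Fin:
  assumes r: "r = to_fract N / to_fract D" and Dz: "poly D z \<noteq> 0"
  shows "rational_map r (Fin z) = Fin (poly N z / poly D z)"
proof -
  obtain n d where nd: "quot_of_fract r = (n, d)" by force
  have "D \<noteq> 0" using Dz by auto
  then have eq: "poly n z * poly D z = poly N z * poly d z"
    by (rule rational_map_cross_mult[OF _ r nd])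
  have "coprime n d" using coprime_quot_of_fract[of r] nd by simp
  \<comment> \<open>At a zero of \<open>d\<close> the cross product would make \<open>n\<close>
    vanish too, against coprimality.\<close>
  then have "poly d z \<noteq> 0"
    using eq Dz coprime_poly_0[of n d z] by auto
  then show ?thesis
    using nd eq Dz by (simp add: rational_map_def field_simps)
qed

text \<open>\<open>D\<close> may vanish at \<open>z\<close>, so fixed points can be located before
  critical points of \<open>p\<close> are ruled out.\<close>

lemma rational_map_Fin_eq_FinD:
  assumes "D \<noteq> 0" "r = to_fract N / to_fract D" "rational_map r (Fin z) = Fin c"
  shows "poly N z = c * poly D z"
proof -
  obtain n d where nd: "quot_of_fract r = (n, d)" by force
  then show ?thesis
    using rational_map_cross_mult[OF assms(1,2) nd, of z] assms(3)
    by (auto simp: rational_map_def split: if_splits)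
qed

definition chebyshev_num :: "complex poly \<Rightarrow> complex poly" where
  "chebyshev_num p = 2 * [:0, 1:] * pderiv p ^ 3 - 2 * p * (pderiv p)\<^sup>2 - p\<^sup>2 * pderiv (pderiv p)"

definition chebyshev_denom :: "complex poly \<Rightarrow> complex poly" where
  "chebyshev_denom p = 2 * pderiv p ^ 3"

lemma chebyshev_fract_eq:
  assumes "pderiv p \<noteq> 0"
  shows "chebyshev_fract p = to_fract (chebyshev_num p) / to_fract (chebyshev_denom p)"
proof -
  have two: "to_fract 2 = (2 :: complex poly fract)"
    by (metis one_add_one to_fract_1 to_fract_add)
  have "(2 :: complex poly fract) \<noteq> 0"
    by (metis two to_fract_eq_0_iff zero_neq_numeral)
  moreover have "to_fract (pderiv p) \<noteq> 0" using assms by simp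
  moreover define x :: "complex poly" where "x = [:0, 1:]"
  ultimately show ?thesis
    unfolding chebyshev_fract_def L_fract_def chebyshev_num_def chebyshev_denom_def x_def[symmetric]
    by (simp add: two power2_eq_square power3_eq_cube divide_simps) (simp add: algebra_simps)
qed

lemma chebyshev_method_Fin:
  assumes "poly (pderiv p) z \<noteq> 0"
  shows "chebyshev_method p (Fin z) =
    Fin (poly (chebyshev_num p) z / poly (chebyshev_denom p) z)"
  unfolding chebyshev_method_def using assms
  by (intro rational_map_Fin chebyshev_fract_eq) (auto simp: chebyshev_denom_def)

text \<open>After clearing denominators, the fixed point equation factors: either \<open>z\<close>
  is a root of \<open>p\<close>, or it is an extraneous fixed point, where \<open>L_p = -2\<close>
  if \<open>p'\<close> does not vanish.\<close>

lemma chebyshev_method_fixpointD: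
  assumes "pderiv p \<noteq> 0" "chebyshev_method p (Fin z) = Fin z"
  shows "poly p z = 0 \<or> 2 * (poly (pderiv p) z)\<^sup>2 + poly p z * poly (pderiv (pderiv p)) z = 0"
proof -
  have "poly (chebyshev_num p) z = z * poly (chebyshev_denom p) z"
    using assms by (intro rational_map_Fin_eq_FinD[OF _ chebyshev_fract_eq])
      (auto simp: chebyshev_denom_def chebyshev_method_def)
  then have "poly p z * (2 * (poly (pderiv p) z)\<^sup>2 + poly p z * poly (pderiv (pderiv p)) z) = 0"
    by (simp add: chebyshev_num_def chebyshev_denom_def algebra_simps power2_eq_square)
  then show ?thesis by simp
qed

text \<open>Where \<open>p''\<close> is nonzero this is the formula
  \<open>L_p^2 (3 - L_{p'}) / 2\<close>. For even \<open>p\<close>, the terms \<open>p\<close>,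
  \<open>p''\<close>, \<open>p' p'''\<close> and \<open>p'^4\<close> are all even, so the derivative
  depends on \<open>z^2\<close> only.\<close>

lemma chebyshev_has_field_derivative:
  assumes "poly (pderiv p) z \<noteq> 0"
  shows "((\<lambda>z. poly (chebyshev_num p) z / poly (chebyshev_denom p) z) has_field_derivative
     (poly p z)\<^sup>2 * (3 * (poly (pderiv (pderiv p)) z)\<^sup>2
        - poly (pderiv p) z * poly (pderiv (pderiv (pderiv p))) z)
     / (2 * poly (pderiv p) z ^ 4)) (at z)"
proof -
  define P Q R T where "P = poly p z" and "Q = poly (pderiv p) z"
    and "R = poly (pderiv (pderiv p)) z" and "T = poly (pderiv (pderiv (pderiv p))) z"
  note PQRT = P_def[symmetric] Q_def[symmetric] R_def[symmetric] T_def[symmetric]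
  have Q: "Q \<noteq> 0" using assms by (simp add: Q_def)
  have n: "poly (pderiv (chebyshev_num p)) z = 6 * z * Q\<^sup>2 * R - 6 * P * Q * R - P\<^sup>2 * T"
    by (simp add: chebyshev_num_def pderiv_add pderiv_diff pderiv_mult pderiv_power pderiv_pCons PQRT
        power2_eq_square power3_eq_cube algebra_simps)
  have d: "poly (pderiv (chebyshev_denom p)) z = 6 * Q\<^sup>2 * R"
    by (simp add: chebyshev_denom_def pderiv_mult pderiv_power PQRT
        power2_eq_square power3_eq_cube algebra_simps)
  have n0: "poly (chebyshev_num p) z = 2 * z * Q ^ 3 - 2 * P * Q\<^sup>2 - P\<^sup>2 * R"
    by (simp add: chebyshev_num_def PQRT)
  have d0: "poly (chebyshev_denom p) z = 2 * Q ^ 3"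
    by (simp add: chebyshev_denom_def PQRT)
  have "((\<lambda>z. poly (chebyshev_num p) z / poly (chebyshev_denom p) z) has_field_derivative
     ((6 * z * Q\<^sup>2 * R - 6 * P * Q * R - P\<^sup>2 * T) * (2 * Q ^ 3)
       - (2 * z * Q ^ 3 - 2 * P * Q\<^sup>2 - P\<^sup>2 * R) * (6 * Q\<^sup>2 * R)) / (2 * Q ^ 3 * (2 * Q ^ 3))) (at z)"
    using DERIV_divide[OF poly_DERIV poly_DERIV, of "chebyshev_denom p" z "chebyshev_num p"] Q
    by (simp add: n d n0 d0)
  also have "(6 * z * Q\<^sup>2 * R - 6 * P * Q * R - P\<^sup>2 * T) * (2 * Q ^ 3)
       - (2 * z * Q ^ 3 - 2 * P * Q\<^sup>2 - P\<^sup>2 * R) * (6 * Q\<^sup>2 * R) = (2 * Q\<^sup>2) * (P\<^sup>2 * (3 * R\<^sup>2 - Q * T))"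
    by (simp add: algebra_simps power2_eq_square power3_eq_cube)
  also have "2 * Q ^ 3 * (2 * Q ^ 3) = (2 * Q\<^sup>2) * (2 * Q ^ 4)"
    by (simp add: eval_nat_numeral)
  also have "(2 * Q\<^sup>2) * (P\<^sup>2 * (3 * R\<^sup>2 - Q * T)) / ((2 * Q\<^sup>2) * (2 * Q ^ 4))
      = P\<^sup>2 * (3 * R\<^sup>2 - Q * T) / (2 * Q ^ 4)"
    using Q by (intro mult_divide_mult_cancel_left) simp
  finally show ?thesis by (simp only: PQRT)
qed

section \<open>The quartic\<close>

lemma p_poly_eq: "p_poly a = [:a, 0, - (1 + a), 0, 1:]"
  by (simp add: p_poly_def power2_eq_square one_pCons)

lemma pderiv_p_poly: "pderiv (p_poly a) = [:0, - 2 * (1 + a), 0, 4:]"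
  by (simp add: p_poly_eq pderiv_pCons)

text \<open>
  With \<open>w = z\<^sup>2\<close>, the polynomial is half of \<open>2 p'\<^sup>2 + p p''\<close>. With \<open>s = 1 + a\<close>, the points \<open>s/6\<close> and \<open>s/2\<close>
  separating its roots are the zeros of \<open>p''\<close> and of \<open>p'\<close>.
\<close>

lemma extraneous_cubic_real_roots:
  fixes a :: real and w :: complex
  assumes a: "a \<in> {-1<..<0} \<union> {0<..<1}"
    and w: "poly [:- of_real (a * (1 + a)), of_real (5 * (1 + a)\<^sup>2 + 6 * a),
      - of_real (23 * (1 + a)), 22:] w = 0"
  shows "w \<in> \<real>"
proof (rule ccontr)
  assume w': "w \<notin> \<real>"
  define s where "s = 1 + a"
  define q where "q = [:- (a * s), 5 * s\<^sup>2 + 6 * a, - (23 * s), 22:]"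
  have s: "s > 0" "s < 2" "a \<noteq> 1" using a by (auto simp: s_def)
  \<comment> \<open>For \<open>w > 0\<close>, \<open>q\<close> is \<open>p'^2 + p p'' / 2\<close>.
    At \<open>s/6\<close> only \<open>p'^2 > 0\<close> survives. At \<open>s/2\<close>, the midpoint
    of the roots \<open>a\<close> and \<open>1\<close> of \<open>p\<close> in \<open>w\<close>, only
    \<open>p p'' / 2\<close> survives, with \<open>p < 0 < p''\<close>. At \<open>1\<close>,
    \<open>p\<close> vanishes and \<open>p'^2 > 0\<close> is left.\<close>
  have "poly q (s / 6) = 64 / 216 * s ^ 3"
    by (simp add: q_def field_simps power2_eq_square power3_eq_cube)
  also have "\<dots> > 0" using s by simp
  finally have q1: "poly q (s / 6) > 0" .
  have "poly q (s / 2) = - (s / 2) * (1 - a)\<^sup>2"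
    by (simp add: q_def field_simps power2_eq_square s_def)
  also have "\<dots> < 0" using s by simp
  finally have q2: "poly q (s / 2) < 0" .
  have "poly q 1 = 4 * (1 - a)\<^sup>2"
    by (simp add: q_def field_simps power2_eq_square s_def)
  then have q3: "poly q 1 > 0" using s by simp
  have q0: "poly q 0 = - (a * s)" by (simp add: q_def)
  have "poly q (-1) = - 50 - 40 * a - 6 * a\<^sup>2"
    by (simp add: q_def field_simps power2_eq_square s_def)
  then have qm: "poly q (-1) < 0" using a by (smt (verit) zero_le_power2 UnE greaterThanLessThan_iff)
  \<comment> \<open>The sign of \<open>q\<close> at \<open>0\<close> is opposite to that of
    \<open>a\<close>: the root found lies in \<open>(0, s/6)\<close> for \<open>a > 0\<close> and in
    \<open>(-1, 0)\<close> for \<open>a < 0\<close>.\<close>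
  obtain x1 where x1: "x1 < s / 6" "poly q x1 = 0"
  proof (cases "a > 0")
    case True
    then show ?thesis using poly_IVT_pos[of 0 "s / 6" q] q0 q1 s that by auto
  next
    case False
    then have "poly q 0 > 0" using a s q0 by (simp add: mult_neg_pos)
    then obtain x where "x < 0" "poly q x = 0" using poly_IVT_pos[of "-1" 0 q] qm by auto
    then show ?thesis using that[of x] s by simp
  qed
  obtain x2 where x2: "s / 6 < x2" "x2 < s / 2" "poly q x2 = 0"
    using poly_IVT_neg[of "s / 6" "s / 2" q] q1 q2 s by auto
  obtain x3 where x3: "s / 2 < x3" "poly q x3 = 0"
    using poly_IVT_pos[of "s / 2" 1 q] q2 q3 s by auto
  \<comment> \<open>Over the complex numbers, a non-real \<open>w\<close> would be a fourth root of
    a cubic.\<close>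
  define Q :: "complex poly" where
    Q: "Q = [:- of_real (a * s), of_real (5 * s\<^sup>2 + 6 * a), - of_real (23 * s), 22:]"
  have Qw: "poly Q w = 0" using w by (simp add: Q s_def)
  have "poly Q (of_real x) = of_real (poly q x)" for x
    by (simp add: Q q_def)
  then have "complex_of_real ` {x1, x2, x3} \<union> {w} \<subseteq> {z. poly Q z = 0}"
    using x1(2) x2(3) x3(2) Qw by auto
  moreover have "Q \<noteq> 0" by (simp add: Q)
  ultimately have "card (complex_of_real ` {x1, x2, x3} \<union> {w}) \<le> degree Q"
    using order_trans[OF card_mono[OF poly_roots_finite] card_poly_roots_bound, of Q] by blast
  moreover have "w \<notin> complex_of_real ` {x1, x2, x3}" using w' by auto
  moreover have "card (complex_of_real ` {x1, x2, x3}) = card {x1, x2, x3}"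
    by (intro card_image) (auto simp: inj_on_def)
  moreover have "card {x1, x2, x3} = 3" using x1 x2 x3 by auto
  ultimately show False by (simp add: Q)
qed

text \<open>The second claim makes the derivative formula applicable. A fixed critical point would
  satisfy \<open>p = 0\<close> or \<open>p p'' = 0\<close>, but at \<open>z^2 = 0\<close> and
  \<open>z^2 = s/2\<close>, with \<open>s = 1 + a\<close>, neither \<open>p\<close> nor
  \<open>p''\<close> vanishes.\<close>

lemma fixpoint_square_real:
  fixes a :: real
  assumes a: "a \<in> {-1<..<0} \<union> {0<..<1}"
    and fp: "chebyshev_method (p_poly (of_real a)) (Fin z) = Fin z"
  shows "z\<^sup>2 \<in> \<real>" "poly (pderiv (p_poly (of_real a))) z \<noteq> 0"
proof -
  let ?p = "p_poly (of_real a)" and ?s = "1 + complex_of_real a"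
  have p: "poly ?p z = (z\<^sup>2 - 1) * (z\<^sup>2 - of_real a)" by (simp add: p_poly_def)
  have p': "poly (pderiv ?p) z = 2 * z * (2 * z\<^sup>2 - ?s)"
    by (simp add: pderiv_p_poly algebra_simps power2_eq_square)
  have p'': "poly (pderiv (pderiv ?p)) z = 12 * z\<^sup>2 - 2 * ?s"
    by (simp add: pderiv_p_poly pderiv_pCons algebra_simps power2_eq_square)
  have ne: "complex_of_real a \<noteq> 0" "complex_of_real a \<noteq> 1" "?s \<noteq> 0"
    using a by (auto simp: complex_eq_iff)
  have cases: "poly ?p z = 0
    \<or> 2 * (poly (pderiv ?p) z)\<^sup>2 + poly ?p z * poly (pderiv (pderiv ?p)) z = 0"
    using chebyshev_method_fixpointD[OF _ fp] by (auto simp: pderiv_p_poly)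
  from cases show "z\<^sup>2 \<in> \<real>"
  proof
    assume "poly ?p z = 0"
    then have "z\<^sup>2 = 1 \<or> z\<^sup>2 = of_real a" by (simp add: p)
    then show ?thesis by auto
  next
    assume 2: "2 * (poly (pderiv ?p) z)\<^sup>2 + poly ?p z * poly (pderiv (pderiv ?p)) z = 0"
    have "2 * poly [:- of_real (a * (1 + a)), of_real (5 * (1 + a)\<^sup>2 + 6 * a),
      - of_real (23 * (1 + a)), 22:] (z\<^sup>2) = 0"
      using 2 unfolding p p' p'' by (simp add: algebra_simps power2_eq_square)
    then show ?thesis using extraneous_cubic_real_roots[OF a] by simp
  qed
  show "poly (pderiv ?p) z \<noteq> 0"
  proof
    assume 0: "poly (pderiv ?p) z = 0"
    then have z: "z\<^sup>2 = 0 \<or> z\<^sup>2 = ?s / 2" by (auto simp: p' mult.commute)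
    have "z\<^sup>2 - 1 \<noteq> 0" "z\<^sup>2 - of_real a \<noteq> 0"
      using z ne by (auto simp: field_simps)
    moreover have "s = 0" if "12 * u - 2 * s = 0" "u = 0 \<or> u = s / 2" for u s :: complex
      using that by auto
    then have "12 * z\<^sup>2 - 2 * ?s \<noteq> 0"
      using z ne(3) by blast
    ultimately show False using cases 0 by (auto simp: p p'')
  qed
qed

text \<open>\<open>A\<close>, \<open>B\<close>, \<open>E\<close> are the reciprocal polynomials of \<open>p\<close>, \<open>p'\<close>, \<open>p''\<close>.\<close>

lemma chebyshev_method_near_Infty:
  fixes a :: complex
  defines "A \<equiv> \<lambda>w. 1 - (1 + a) * w\<^sup>2 + a * w ^ 4" and "B \<equiv> \<lambda>w. 4 - 2 * (1 + a) * w\<^sup>2"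
    and "E \<equiv> \<lambda>w. 12 - 2 * (1 + a) * w\<^sup>2"
  defines "N \<equiv> \<lambda>w. 2 * B w ^ 3 - 2 * A w * (B w)\<^sup>2 - (A w)\<^sup>2 * E w"
  assumes w: "w \<noteq> 0" "B w \<noteq> 0" "N w \<noteq> 0"
  shows "chebyshev_method (p_poly a) (chart_Infty w) = chart_Infty (w * (2 * B w ^ 3 / N w))"
proof -
  let ?p = "p_poly a"
  have p: "poly ?p (1 / w) = A w / w ^ 4"
    using w(1) by (simp add: p_poly_eq A_def field_simps power2_eq_square power4_eq_xxxx)
  have p': "poly (pderiv ?p) (1 / w) = B w / w ^ 3"
    using w(1) by (simp add: pderiv_p_poly B_def field_simps power2_eq_square power3_eq_cube)
  have p'': "poly (pderiv (pderiv ?p)) (1 / w) = E w / w\<^sup>2"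
    using w(1) by (simp add: pderiv_p_poly pderiv_pCons E_def field_simps power2_eq_square)
  \<comment> \<open>All three terms of the numerator have degree 10 and the denominator has degree
    9; the surplus power is the factor \<open>w\<close> in the conclusion.\<close>
  have n: "poly (chebyshev_num ?p) (1 / w) = N w / w ^ 10"
    using w(1) unfolding chebyshev_num_def N_def by (simp add: p p' p'' power_divide field_simps)
      (simp add: eval_nat_numeral)
  have d: "poly (chebyshev_denom ?p) (1 / w) = 2 * B w ^ 3 / w ^ 9"
    using w(1) unfolding chebyshev_denom_def by (simp add: p' power_divide)
  have w10: "w ^ 10 = w * w ^ 9"
    by (simp add: eval_nat_numeral)
  have "chebyshev_method ?p (Fin (1 / w)) =
      Fin (poly (chebyshev_num ?p) (1 / w) / poly (chebyshev_denom ?p) (1 / w))"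
    using w by (intro chebyshev_method_Fin) (simp add: p')
  then show ?thesis
    unfolding n d w10 using w by (simp add: chart_Infty_def)
qed

theorem mainTheorem5:
  fixes a :: real
  assumes "a \<in> {-1<..<0} \<union> {0<..<1}"
  shows "\<not> (\<exists>U. invariant_Siegel_disk (chebyshev_method (p_poly (of_real a))) U)"
proof
  let ?p = "p_poly (of_real a)" and ?s = "1 + complex_of_real a"
  let ?F = "chebyshev_method ?p"
  assume "\<exists>U. invariant_Siegel_disk ?F U"
  then obtain U \<phi> \<alpha> where U: "U \<in> components (fatou_set ?F)" "?F ` U = U"
    and hol: "(\<phi> \<circ> Fin) holomorphic_on (Fin -` U)"
      "(\<phi> \<circ> chart_Infty) holomorphic_on (chart_Infty -` U)"
    and bij: "bij_betw \<phi> U (ball 0 1)" and \<alpha>: "\<alpha> \<notin> \<rat>"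
    and lin: "\<And>x. x \<in> U \<Longrightarrow> \<phi> (?F x) = exp (2 * of_real pi * \<i> * of_real \<alpha>) * \<phi> x"
    unfolding invariant_Siegel_disk_def sphere_holomorphic_on_def by blast
  let ?c = "exp (2 * complex_of_real pi * \<i> * of_real \<alpha>)"
  have inj: "inj_on \<phi> U" using bij by (simp add: bij_betw_def)
  \<comment> \<open>The centre of the disk is the preimage of the fixed point \<open>0\<close> of
    the rotation; injectivity of \<open>\<phi>\<close> on the invariant \<open>U\<close> makes it
    fixed by \<open>?F\<close>.\<close>
  have "0 \<in> \<phi> ` U" using bij by (simp add: bij_betw_def)
  then obtain x where x: "x \<in> U" "\<phi> x = 0" by auto
  then have fp: "?F x = x"
    using lin[OF x(1)] U(2) inj by (metis image_eqI inj_onD mult_zero_right)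
  have "?c \<in> \<real>"
  proof (cases x)
    case (Fin z)
    have z: "z\<^sup>2 \<in> \<real>" "poly (pderiv ?p) z \<noteq> 0"
      using fixpoint_square_real[OF assms] fp Fin by auto
    define G where "G = (\<lambda>z. poly (chebyshev_num ?p) z / poly (chebyshev_denom ?p) z)"
    define l where "l = (poly ?p z)\<^sup>2 * (3 * (poly (pderiv (pderiv ?p)) z)\<^sup>2
        - poly (pderiv ?p) z * poly (pderiv (pderiv (pderiv ?p))) z) / (2 * poly (pderiv ?p) z ^ 4)"
    have "\<forall>\<^sub>F y in nhds z. poly (pderiv ?p) y \<noteq> 0"
      using z(2) by (intro tendsto_imp_eventually_ne[of _ "poly (pderiv ?p) z"] tendsto_intros)
        (simp_all add: filterlim_ident)
    then have "\<forall>\<^sub>F y in nhds z. ?F (Fin y) = Fin (G y)"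
      by eventually_elim (simp add: chebyshev_method_Fin G_def)
    moreover have "G z = z"
      using fp Fin chebyshev_method_Fin[OF z(2)] by (simp add: G_def)
    moreover have "(G has_field_derivative l) (at z)"
      unfolding G_def l_def by (rule chebyshev_has_field_derivative[OF z(2)])
    ultimately have "l = ?c"
      using x Fin by (intro multiplier_of_linearisation[OF continuous_on_Fin _ U(1) hol(1) inj lin])
        (auto simp: inj_def)
    moreover have "l \<in> \<real>"
    proof -
      \<comment> \<open>Odd derivatives enter \<open>l\<close> only through \<open>p' p'''\<close>
        and \<open>p'^4\<close>, so everything is a real expression in \<open>t\<close>.\<close>
      obtain t where t: "z\<^sup>2 = of_real t" using z(1) by (auto elim: Reals_cases)
      have "poly ?p z = (z\<^sup>2 - 1) * (z\<^sup>2 - of_real a)" by (simp add: p_poly_def)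
      moreover have "poly (pderiv (pderiv ?p)) z = 12 * z\<^sup>2 - 2 * ?s"
        by (simp add: pderiv_p_poly pderiv_pCons algebra_simps power2_eq_square)
      moreover have "poly (pderiv ?p) z * poly (pderiv (pderiv (pderiv ?p))) z
          = 48 * z\<^sup>2 * (2 * z\<^sup>2 - ?s)"
        by (simp add: pderiv_p_poly pderiv_pCons algebra_simps power2_eq_square)
      moreover have "poly (pderiv ?p) z ^ 4 = 16 * (z\<^sup>2)\<^sup>2 * (2 * z\<^sup>2 - ?s) ^ 4"
        by (simp add: pderiv_p_poly algebra_simps power2_eq_square power4_eq_xxxx)
      ultimately show ?thesis
        unfolding l_def t by (auto intro!: Reals_mult Reals_divide Reals_diff Reals_add Reals_power)
    qed
    ultimately show ?thesis by simp
  next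
    case Infty
    define A where "A = (\<lambda>w. 1 - ?s * w\<^sup>2 + of_real a * w ^ 4)"
    define B where "B = (\<lambda>w. 4 - 2 * ?s * w\<^sup>2)"
    define N where "N = (\<lambda>w. 2 * B w ^ 3 - 2 * A w * (B w)\<^sup>2 - (A w)\<^sup>2 * (12 - 2 * ?s * w\<^sup>2))"
    define H where "H = (\<lambda>w. 2 * B w ^ 3 / N w)"
    \<comment> \<open>\<open>84 = 2 * 64 - 2 * 16 - 12\<close>, so
      \<open>H 0 = 128 / 84 = 32 / 21\<close>.\<close>
    have 0: "A 0 = 1" "B 0 = 4" "N 0 = 84" by (simp_all add: A_def B_def N_def)
    have cont: "isCont B 0" "isCont N 0"
      unfolding N_def A_def B_def by (intro continuous_intros)+
    then have "(B \<longlongrightarrow> B 0) (nhds 0)" "(N \<longlongrightarrow> N 0) (nhds 0)"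
      unfolding isCont_def by (simp_all only: tendsto_at_iff_tendsto_nhds)
    then have "\<forall>\<^sub>F w in nhds 0. B w \<noteq> 0 \<and> N w \<noteq> 0"
      using 0 by (intro eventually_conj tendsto_imp_eventually_ne[of B "B 0"]
          tendsto_imp_eventually_ne[of N "N 0"]) simp_all
    then have "\<forall>\<^sub>F w in nhds 0. ?F (chart_Infty w) = chart_Infty (w * H w)"
    proof eventually_elim
      case (elim w)
      show ?case
      proof (cases "w = 0")
        case True
        then show ?thesis using fp Infty by (simp add: chart_Infty_def)
      next
        case False
        then show ?thesis
          using elim chebyshev_method_near_Infty[of w "of_real a"]
          by (simp add: H_def N_def A_def B_def)
      qed
    qed
    \<comment> \<open>By Caratheodory's criterion, continuity of \<open>H\<close> at
      \<open>0\<close> suffices and the derivative is \<open>H 0\<close>.\<close>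
    moreover have "((\<lambda>w. w * H w) has_field_derivative 32 / 21) (at 0)"
    proof -
      have "isCont H 0" "H 0 = 32 / 21"
        unfolding H_def using cont 0 by (auto intro!: continuous_intros)
      then show ?thesis by (subst CARAT_DERIV) (auto simp: mult.commute)
    qed
    ultimately have "32 / 21 = ?c"
      using x Infty by (intro multiplier_of_linearisation[OF continuous_on_chart_Infty inj_chart_Infty
            U(1) hol(2) inj lin, of 0 "\<lambda>w. w * H w"]) (auto simp: chart_Infty_def)
    then show ?thesis by (metis Reals_divide Reals_numeral)
  qed
  then show False using Rats_if_exp_2pi_i_real \<alpha> by blast
qed

end
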